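(* Let $K\ge 1$, let $\mathcal{K}=\{1,\dots,K\}$, let $P_k>0$ and $\boldsymbol{H}_k\in\mathbb{C}^{N_t\times N_d}$ for $k\in\mathcal{K}$, let $\sigma^2>0$, and let $0<r_{\min}\le 1\le r_{\max}$. Let $\boldsymbol{m}\in\mathbb{C}^{N_t}$ be any given vector with $\|\boldsymbol{m}\|=1$ and $\boldsymbol{m}^{\mathrm{H}}\boldsymbol{H}_k\neq 0$ for all $k\in\mathcal{K}$. Let $$\mathcal{R}=\Big\{(r_1,\dots,r_K):\ r_k\in[r_{\min},r_{\max}]\ \forall k\in\mathcal{K},\ \ \sum_{k=1}^K\frac{1}{K r_k}=1\Big\},$$ and for $r\in\mathcal{R}$ let $$\mathrm{MSE}(r)=\sigma^2\max_{k\in\mathcal{K}}\frac{\|\boldsymbol{m}\|^2}{K^2P_k r_k^2\|\boldsymbol{m}^{\mathrm{H}}\boldsymbol{H}_k\|^2}.$$ Define $$\mathrm{MSE^{lbm}}=\frac{\sigma^2}{\left(\sum_{i=1}^K\sqrt{P_i}\,\|\boldsymbol{m}^{\mathrm{H}}\boldsymbol{H}_i\|\right)^2},\qquad \mathrm{MSE^{d}}=\min_{r\in\mathcal{R}}\mathrm{MSE}(r),\qquad \mathrm{MSE^{n}}=\mathrm{MSE}(1,\dots,1).$$ Then $\mathrm{MSE}(r)\ge\mathrm{MSE^{lbm}}$ for every $r\in\mathcal{R}$, and $$\mathrm{MSE^{n}}\overset{(a)}{\ge}\mathrm{MSE^{d}}\overset{(b)}{\ge}\mathrm{MSE^{lbm}}.$$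 Equality holds in (a) when $\sqrt{P_i}\|\boldsymbol{m}^{\mathrm{H}}\boldsymbol{H}_i\|=\sqrt{P_j}\|\boldsymbol{m}^{\mathrm{H}}\boldsymbol{H}_j\|$ for all $i,j\in\mathcal{K}$, and equality holds in (b) when, for $r\in\mathcal{R}$ attaining the minimum $\mathrm{MSE^d}$, $r_i\sqrt{P_i}\|\boldsymbol{m}^{\mathrm{H}}\boldsymbol{H}_i\|=r_j\sqrt{P_j}\|\boldsymbol{m}^{\mathrm{H}}\boldsymbol{H}_j\|$ for all $i,j\in\mathcal{K}$.
   Context: MIMO over-the-air computation: $K$ devices, each with $N_d$ antennas, transmit to an aggregator with $N_t$ antennas. $\boldsymbol{H}_k$ is the channel matrix of device $k$, $\boldsymbol{m}$ the receive beamforming vector at the aggregator (normalized to $\|\boldsymbol{m}\|=1$), $P_k$ the maximum transmit power of device $k$, $\sigma^2$ the noise power, $\|\cdot\|$ the Euclidean norm, and $^{\mathrm H}$ the conjugate transpose. $r_k=\mu_k/\mu$ is the dynamic learning rate (DLR) ratio of device $k$ (local learning rate over global learning rate). After the transmit vectors and the scaling factor are chosen so that the fading-induced error is eliminated under the power constraints, the residual mean square error for given $\boldsymbol{m}$ as a function of the ratios is the quantity $\mathrm{MSE}(r)$ given in the claim, and the feasible ratios are those in $\mathcal{R}$. $\mathrm{MSE^d}$ is the MSE obtained with DLR (optimized ratios) and $\mathrm{MSE^n}$ is the MSE obtained without DLR (all ratios equal to $1$). *)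

theory Defs
  imports "HOL-Analysis.Analysis"
begin

text \<open>
  The devices are the elements of a finite type \<open>'k\<close>, so \<open>K = CARD('k)\<close>; the numbers of antennas
  at the aggregator and at each device are \<open>CARD('t)\<close> and \<open>CARD('d)\<close>. A channel matrix has type
  \<open>complex ^ 'd ^ 't\<close>, i.e. rows are indexed by \<open>'t\<close> and columns by \<open>'d\<close>.
\<close>

text \<open>The row vector \<open>m\<^sup>H H\<close>.\<close>

definition herm_mult :: "complex ^ 't \<Rightarrow> complex ^ 'd ^ 't \<Rightarrow> complex ^ 'd" where
  "herm_mult m H = (\<chi> i. cnj (m $ i)) v* H"

definition feasible_ratios :: "real \<Rightarrow> real \<Rightarrow> (real ^ 'k) set" where
  "feasible_ratios rmin rmax =
     {r. (\<forall>k. r $ k \<in> {rmin..rmax}) \<and> (\<Sum>k\<in>UNIV. 1 / (real CARD('k) * r $ k)) = 1}"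

definition MSE ::
  "real \<Rightarrow> ('k::finite \<Rightarrow> real) \<Rightarrow> ('k \<Rightarrow> complex ^ 'd ^ 't) \<Rightarrow> complex ^ 't \<Rightarrow> real ^ 'k \<Rightarrow> real" where
  "MSE \<sigma> P H m r = \<sigma>\<^sup>2 *
     (MAX k\<in>UNIV. (norm m)\<^sup>2 /
        ((real CARD('k))\<^sup>2 * P k * (r $ k)\<^sup>2 * (norm (herm_mult m (H k)))\<^sup>2))"

definition MSE_lbm ::
  "real \<Rightarrow> ('k::finite \<Rightarrow> real) \<Rightarrow> ('k \<Rightarrow> complex ^ 'd ^ 't) \<Rightarrow> complex ^ 't \<Rightarrow> real" where
  "MSE_lbm \<sigma> P H m = \<sigma>\<^sup>2 / (\<Sum>i\<in>UNIV. sqrt (P i) * norm (herm_mult m (H i)))\<^sup>2"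

text \<open>
  \<open>LEAST\<close> denotes the minimum of the set of attained values only if that minimum exists;
  its existence has to be established separately.
\<close>

definition MSE_d ::
  "real \<Rightarrow> ('k::finite \<Rightarrow> real) \<Rightarrow> ('k \<Rightarrow> complex ^ 'd ^ 't) \<Rightarrow> complex ^ 't \<Rightarrow> real \<Rightarrow> real \<Rightarrow> real" where
  "MSE_d \<sigma> P H m rmin rmax = (LEAST v. v \<in> MSE \<sigma> P H m ` feasible_ratios rmin rmax)"

definition MSE_n ::
  "real \<Rightarrow> ('k::finite \<Rightarrow> real) \<Rightarrow> ('k \<Rightarrow> complex ^ 'd ^ 't) \<Rightarrow> complex ^ 't \<Rightarrow> real" where
  "MSE_n \<sigma> P H m = MSE \<sigma> P H m (\<chi> k. 1)"

end

theory Submission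
  imports Defs
begin

text \<open>
  With \<open>g k = \<surd>P\<^sub>k \<parallel>m\<^sup>H H\<^sub>k\<parallel>\<close> the mean square error is \<open>\<sigma>\<^sup>2\<close> times the maximum of the squares of
  \<open>1 / (K r\<^sub>k g k)\<close>. The constraint says that the average of these numbers with weights
  proportional to \<open>g k\<close> is \<open>1 / (\<Sum>i. g i)\<close>, so their maximum is at least that, with equality
  if they all coincide. The minimum exists because the feasible set is compact.
\<close>

text \<open>Splitting off one index turns the finite maximum into a binary \<open>max\<close>, so
  induction on \<open>I\<close> carries continuity along. It is needed because \<open>MSE\<close> is
  a maximum over devices.\<close>

lemma continuous_on_Max_image:
  fixes f :: "'i \<Rightarrow> 'a::topological_space \<Rightarrow> real"
  assumes "finite I" "I \<noteq> {}" "\<And>i. i \<in> I \<Longrightarrow> continuous_on S (f i)"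
  shows "continuous_on S (\<lambda>x. MAX i\<in>I. f i x)"
  using assms
proof (induction I rule: finite_ne_induct)
  case (singleton i)
  then show ?case by simp
next
  case (insert i I)
  have "(\<lambda>x. MAX j\<in>insert i I. f j x) = (\<lambda>x. max (f i x) (MAX j\<in>I. f j x))"
    using insert.hyps by simp
  then show ?case
    using insert by (auto intro: continuous_on_max)
qed

text \<open>Gives meaning to the \<open>LEAST\<close> in \<open>MSE_d\<close>: once a minimizer is
  known, \<open>MSE_d\<close> is the value attained there.\<close>

lemma Least_eq_if_is_arg_min:
  fixes f :: "'a \<Rightarrow> 'b::linorder"
  assumes "is_arg_min f (\<lambda>x. x \<in> S) x"
  shows "(LEAST v. v \<in> f ` S) = f x"
  using assms by (intro Least_equality) (auto simp: is_arg_min_linorder)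

lemma feasible_ratios_pos:
  assumes "0 < rmin" "r \<in> feasible_ratios rmin rmax"
  shows "0 < r $ k"
  using assms by (force simp: feasible_ratios_def intro: less_le_trans)

lemma feasible_ratios_sum:
  assumes "r \<in> feasible_ratios rmin rmax"
  shows "(\<Sum>k\<in>UNIV. 1 / (real CARD('k) * (r :: real ^ 'k) $ k)) = 1"
  using assms by (simp add: feasible_ratios_def)

lemma one_feasible:
  assumes "rmin \<le> 1" "1 \<le> rmax"
  shows "(\<chi> k. 1) \<in> feasible_ratios rmin rmax"
  using assms by (simp add: feasible_ratios_def)

text \<open>On the box the coordinates stay at least \<open>rmin\<close> > 0, so the constraint
  function is continuous there and its level set is closed; a closed part of a compact box is
  compact.\<close>

lemma compact_feasible_ratios:
  assumes "0 < rmin"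
  shows "compact (feasible_ratios rmin rmax :: (real ^ 'k) set)"
proof -
  let ?B = "cbox (\<chi> k. rmin) (\<chi> k. rmax) :: (real ^ 'k) set"
  let ?h = "\<lambda>r :: real ^ 'k. \<Sum>k\<in>UNIV. 1 / (real CARD('k) * r $ k)"
  have "r $ k \<noteq> 0" if "r \<in> ?B" for r k
  proof -
    have "rmin \<le> r $ k"
      using that by (simp add: mem_box_cart)
    then show ?thesis
      using assms by simp
  qed
  then have "continuous_on ?B ?h"
    by (intro continuous_intros) auto
  then have "closed {r \<in> ?B. ?h r = 1}"
    by (intro continuous_closed_preimage_constant) auto
  \<comment> \<open>The box occurs twice: closedness is available for the level set inside the box,
    and intersecting with the compact box yields compactness.\<close>
  moreover have "feasible_ratios rmin rmax = ?B \<inter> {r \<in> ?B. ?h r = 1}"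
    by (auto simp: feasible_ratios_def mem_box_cart)
  ultimately show ?thesis
    by (simp add: compact_Int_closed compact_cbox)
qed

text \<open>With \<open>norm m = 1\<close> and \<open>P k\<close> written as the square of its root,
  each fraction is the square of a single reciprocal, which can be averaged and compared without
  squares.\<close>

lemma MSE_eq:
  fixes P :: "'k::finite \<Rightarrow> real"
  assumes "\<And>k. P k > 0" "norm m = 1"
  shows "MSE \<sigma> P H m r = \<sigma>\<^sup>2 *
    (MAX k\<in>UNIV. (1 / (real CARD('k) * r $ k * (sqrt (P k) * norm (herm_mult m (H k)))))\<^sup>2)"
  using assms by (simp add: MSE_def power_mult_distrib power_divide less_imp_le mult_ac)

lemma MSE_ge_lbm:
  fixes P :: "'k::finite \<Rightarrow> real"
  assumes P: "\<And>k. P k > 0" and m: "norm m = 1" and H: "\<And>k. herm_mult m (H k) \<noteq> 0"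
    and r: "r \<in> feasible_ratios rmin rmax"
  shows "MSE_lbm \<sigma> P H m \<le> MSE \<sigma> P H m r"
proof -
  define g where "g k = sqrt (P k) * norm (herm_mult m (H k))" for k
  define b where "b k = 1 / (real CARD('k) * r $ k * g k)" for k
  define M where "M = (MAX k\<in>UNIV. (b k)\<^sup>2)"
  have g: "0 < g k" for k
    using P H by (simp add: g_def)
  have bM: "(b k)\<^sup>2 \<le> M" for k
    by (simp add: M_def)
  have "0 \<le> M"
    using bM zero_le_power2 order_trans by blast
  \<comment> \<open>The weight \<open>g k\<close> cancels against the same factor in the denominator
    of \<open>b k\<close>, and what remains is the feasibility constraint.\<close>
  have "1 = (\<Sum>k\<in>UNIV. b k * g k)"
    using feasible_ratios_sum[OF r] g by (simp add: b_def less_imp_neq[symmetric])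
  \<comment> \<open>Each \<open>b k\<close> is at most \<open>sqrt M\<close>, since its square is at
    most \<open>M\<close>.\<close>
  also have "\<dots> \<le> (\<Sum>k\<in>UNIV. sqrt M * g k)"
    using g bM by (intro sum_mono mult_right_mono real_le_rsqrt) (auto intro: less_imp_le)
  finally have "1 \<le> sqrt M * (\<Sum>k\<in>UNIV. g k)"
    by (simp add: sum_distrib_left)
  then have "1 \<le> (sqrt M * (\<Sum>k\<in>UNIV. g k))\<^sup>2"
    by simp
  then have "1 \<le> M * (\<Sum>k\<in>UNIV. g k)\<^sup>2"
    using \<open>0 \<le> M\<close> by (simp add: power_mult_distrib)
  moreover have "0 < (\<Sum>k\<in>UNIV. g k)"
    using g by (intro sum_pos) auto
  ultimately have "1 / (\<Sum>k\<in>UNIV. g k)\<^sup>2 \<le> M"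
    by (simp add: divide_simps)
  then have "\<sigma>\<^sup>2 * (1 / (\<Sum>k\<in>UNIV. g k)\<^sup>2) \<le> \<sigma>\<^sup>2 * M"
    by (intro mult_left_mono) auto
  then show ?thesis
    by (simp add: MSE_lbm_def MSE_eq[OF P m] M_def b_def g_def)
qed

text \<open>If all products of ratio and gain equal \<open>c\<close>, every term of the maximum is
  the square of 1 / (K c). Each gain is \<open>c\<close> divided by its ratio, so by the constraint
  the gains sum to K c, which is the root in the denominator of the bound.\<close>

lemma MSE_eq_lbm_if_balanced:
  fixes P :: "'k::finite \<Rightarrow> real"
  assumes P: "\<And>k. P k > 0" and m: "norm m = 1" and "0 < rmin"
    and r: "r \<in> feasible_ratios rmin rmax"
    and balanced: "\<And>i j. r $ i * sqrt (P i) * norm (herm_mult m (H i)) =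
      r $ j * sqrt (P j) * norm (herm_mult m (H j))"
  shows "MSE \<sigma> P H m r = MSE_lbm \<sigma> P H m"
proof -
  \<comment> \<open>\<open>undefined\<close> merely picks some device; by balance any other gives
    the same \<open>c\<close>.\<close>
  define c where "c = r $ undefined * (sqrt (P undefined) * norm (herm_mult m (H undefined)))"
  have c: "r $ k * (sqrt (P k) * norm (herm_mult m (H k))) = c" for k
    using balanced[of k undefined] by (simp only: c_def mult.assoc)
  have rpos: "0 < r $ k" for k
    using feasible_ratios_pos[OF \<open>0 < rmin\<close> r] .
  have "(\<Sum>k\<in>UNIV. sqrt (P k) * norm (herm_mult m (H k))) =
      (\<Sum>k\<in>UNIV. real CARD('k) * c * (1 / (real CARD('k) * r $ k)))"
  proof (intro sum.cong refl)
    fix k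
    show "sqrt (P k) * norm (herm_mult m (H k)) = real CARD('k) * c * (1 / (real CARD('k) * r $ k))"
      using c[of k] rpos[of k] by (simp add: field_simps)
  qed
  also have "\<dots> = real CARD('k) * c"
    using feasible_ratios_sum[OF r] by (simp only: sum_distrib_left[symmetric] mult_1_right)
  finally show ?thesis
    by (simp add: MSE_lbm_def MSE_eq[OF P m] mult.assoc c power_divide)
qed

text \<open>Extreme value theorem: \<open>MSE\<close> is continuous on the compact set of feasible
  ratios, which contains the all-ones vector.\<close>

lemma MSE_minimum_exists:
  fixes P :: "'k::finite \<Rightarrow> real"
  assumes P: "\<And>k. P k > 0" and H: "\<And>k. herm_mult m (H k) \<noteq> 0"
    and "0 < rmin" "rmin \<le> 1" "1 \<le> rmax"
  shows "\<exists>r. is_arg_min (MSE \<sigma> P H m) (\<lambda>r. r \<in> feasible_ratios rmin rmax) r"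
proof -
  have "(real CARD('k))\<^sup>2 * P k * (r $ k)\<^sup>2 * (norm (herm_mult m (H k)))\<^sup>2 \<noteq> 0"
    if "r \<in> feasible_ratios rmin rmax" for r :: "real ^ 'k" and k
    using P[of k] H[of k] feasible_ratios_pos[OF \<open>0 < rmin\<close> that, of k] by simp
  then have "continuous_on (feasible_ratios rmin rmax)
      (\<lambda>r. (norm m)\<^sup>2 / ((real CARD('k))\<^sup>2 * P k * (r $ k)\<^sup>2 * (norm (herm_mult m (H k)))\<^sup>2))" for k
    by (intro continuous_intros) blast
  then have "continuous_on (feasible_ratios rmin rmax) (MSE \<sigma> P H m)"
    unfolding MSE_def
    by (intro continuous_on_mult continuous_on_const continuous_on_Max_image) simp_all
  moreover have "feasible_ratios rmin rmax \<noteq> ({} :: (real ^ 'k) set)"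
    using one_feasible assms(4,5) by blast
  ultimately obtain r where "r \<in> feasible_ratios rmin rmax"
    and "\<forall>s \<in> feasible_ratios rmin rmax. MSE \<sigma> P H m r \<le> MSE \<sigma> P H m s"
    using continuous_attains_inf[OF compact_feasible_ratios[OF \<open>0 < rmin\<close>]] by metis
  then have "is_arg_min (MSE \<sigma> P H m) (\<lambda>r. r \<in> feasible_ratios rmin rmax) r"
    unfolding is_arg_min_linorder by simp
  then show ?thesis ..
qed

theorem theorem3:
  fixes \<sigma> rmin rmax :: real
    and P :: "'k::finite \<Rightarrow> real"
    and H :: "'k \<Rightarrow> complex ^ 'd ^ 't"
    and m :: "complex ^ 't"
  assumes "\<sigma>\<^sup>2 > 0"
    and "\<And>k. P k > 0"
    and "0 < rmin" and "rmin \<le> 1" and "1 \<le> rmax"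
    and "norm m = 1"
    and "\<And>k. herm_mult m (H k) \<noteq> 0"
  shows
    "(\<forall>r \<in> feasible_ratios rmin rmax. MSE \<sigma> P H m r \<ge> MSE_lbm \<sigma> P H m) \<and>
     (\<exists>r. is_arg_min (MSE \<sigma> P H m) (\<lambda>r. r \<in> feasible_ratios rmin rmax) r \<and>
          MSE \<sigma> P H m r = MSE_d \<sigma> P H m rmin rmax) \<and>
     MSE_n \<sigma> P H m \<ge> MSE_d \<sigma> P H m rmin rmax \<and>
     MSE_d \<sigma> P H m rmin rmax \<ge> MSE_lbm \<sigma> P H m \<and>
     ((\<forall>i j. sqrt (P i) * norm (herm_mult m (H i)) = sqrt (P j) * norm (herm_mult m (H j))) \<longrightarrow>
        MSE_n \<sigma> P H m = MSE_d \<sigma> P H m rmin rmax) \<and>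
     (\<forall>r \<in> feasible_ratios rmin rmax.
        MSE \<sigma> P H m r = MSE_d \<sigma> P H m rmin rmax \<longrightarrow>
        (\<forall>i j. r $ i * sqrt (P i) * norm (herm_mult m (H i)) =
               r $ j * sqrt (P j) * norm (herm_mult m (H j))) \<longrightarrow>
        MSE_d \<sigma> P H m rmin rmax = MSE_lbm \<sigma> P H m)"
proof -
  let ?F = "feasible_ratios rmin rmax :: (real ^ 'k) set"
  let ?g = "\<lambda>k. sqrt (P k) * norm (herm_mult m (H k))"
  obtain r0 where r0: "is_arg_min (MSE \<sigma> P H m) (\<lambda>r. r \<in> ?F) r0"
    using MSE_minimum_exists[where P = P and H = H] assms by blast
  then have d: "MSE \<sigma> P H m r0 = MSE_d \<sigma> P H m rmin rmax"
    by (simp add: MSE_d_def Least_eq_if_is_arg_min)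
  have r0F: "r0 \<in> ?F" and min: "\<And>r. r \<in> ?F \<Longrightarrow> MSE_d \<sigma> P H m rmin rmax \<le> MSE \<sigma> P H m r"
    using r0 d by (auto simp: is_arg_min_linorder)
  have lower: "MSE_lbm \<sigma> P H m \<le> MSE \<sigma> P H m r" if "r \<in> ?F" for r
    using MSE_ge_lbm[where P = P and H = H] assms that by blast
  have ba: "MSE \<sigma> P H m r = MSE_lbm \<sigma> P H m"
    if "r \<in> ?F" "\<forall>i j. r $ i * sqrt (P i) * norm (herm_mult m (H i)) =
      r $ j * sqrt (P j) * norm (herm_mult m (H j))" for r
    using MSE_eq_lbm_if_balanced[where P = P and H = H] assms that by blast
  have one: "(\<chi> k. 1) \<in> ?F"
    using assms one_feasible by blast
  have b: "MSE_lbm \<sigma> P H m \<le> MSE_d \<sigma> P H m rmin rmax"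
    using lower[OF r0F] d by simp
  have a: "MSE_d \<sigma> P H m rmin rmax \<le> MSE_n \<sigma> P H m"
    using min[OF one] by (simp add: MSE_n_def)
  have a_eq: "MSE_n \<sigma> P H m = MSE_d \<sigma> P H m rmin rmax" if "\<forall>i j. ?g i = ?g j"
  proof -
    \<comment> \<open>For equal gains the all-ones vector is itself balanced, so it attains the
      lower bound; \<open>MSE_d\<close> is then squeezed between \<open>MSE_lbm\<close> and
      \<open>MSE_n\<close>.\<close>
    have "MSE_n \<sigma> P H m = MSE_lbm \<sigma> P H m"
      unfolding MSE_n_def
      by (rule ba[OF one]) (simp only: vec_lambda_beta mult_1, fact that)
    then show ?thesis
      using a b by simp
  qed
  show ?thesis
  proof (intro conjI)
    show "\<forall>r\<in>?F. MSE_lbm \<sigma> P H m \<le> MSE \<sigma> P H m r"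
      using lower by blast
    show "\<exists>r. is_arg_min (MSE \<sigma> P H m) (\<lambda>r. r \<in> ?F) r \<and> MSE \<sigma> P H m r = MSE_d \<sigma> P H m rmin rmax"
      using r0 d by blast
    show "(\<forall>i j. ?g i = ?g j) \<longrightarrow> MSE_n \<sigma> P H m = MSE_d \<sigma> P H m rmin rmax"
      using a_eq by blast
    show "\<forall>r\<in>?F. MSE \<sigma> P H m r = MSE_d \<sigma> P H m rmin rmax \<longrightarrow>
        (\<forall>i j. r $ i * sqrt (P i) * norm (herm_mult m (H i)) =
               r $ j * sqrt (P j) * norm (herm_mult m (H j))) \<longrightarrow>
        MSE_d \<sigma> P H m rmin rmax = MSE_lbm \<sigma> P H m"
    proof (intro ballI impI)
      fix r
      assume r: "r \<in> ?F" and rd: "MSE \<sigma> P H m r = MSE_d \<sigma> P H m rmin rmax"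
        and balanced: "\<forall>i j. r $ i * sqrt (P i) * norm (herm_mult m (H i)) =
               r $ j * sqrt (P j) * norm (herm_mult m (H j))"
      \<comment> \<open>Rewriting \<open>MSE_d\<close> as the value at \<open>r\<close> reduces the
        claim to the balanced case \<open>ba\<close>.\<close>
      show "MSE_d \<sigma> P H m rmin rmax = MSE_lbm \<sigma> P H m"
        unfolding rd[symmetric] using r balanced by (rule ba)
    qed
  qed (fact a b)+
qed

end
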